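(* Problem (SDIPTC$_{BH}$) can be solved by Algorithm A (both described in the context) in $O(n)$ time.
   Context: Let $T=(V,E)$ be a tree rooted at $s$ with node set $V=\{s,v_1,\dots,v_n\}$ and edge set $E=\{e_1,\dots,e_n\}$, and let $Y=\{t_1,\dots,t_r\}$ be its set of leaf nodes. Each edge $e$ has an original weight $w(e)$, an upper bound $u(e)$ and a cost $c(e)$, with $u(e)\ge w(e)\ge 0$ and $c(e)>0$. For $t_k\in Y$, $P_k$ is the path from $s$ to $t_k$. For $e\in E$, $L(e)=\{t_k\in Y: e\in P_k\}$. For an edge weight vector $x$, put $x(P_k)=\sum_{e\in P_k}x(e)$ and $x(T)=\sum_{t_k\in Y}x(P_k)$ (the sum of root-leaf distances). $H(a,b)=0$ if $a=b$ and $H(a,b)=1$ if $a\ne b$. Given values $K$ and $N$, problem (SDIPTC$_{BH}$) is: maximize $\tilde w(T)$ over $\tilde w$ subject to $\max_{e\in E}c(e)H(\tilde w(e),w(e))\le K$, $\sum_{e\in E}H(\tilde w(e),w(e))\le N$, and $w(e)\le\tilde w(e)\le u(e)$ for all $e\in E$. Algorithm A (input $T,n,w,u,c,K,N$; output $\tilde w$ and $\tilde w(T)$): 1. Put $\tilde E_\le:=\{e\in E: c(e)\le K\}$. 2. If $|\tilde E_\le|>N$: put $S(e):=|L(e)|(u(e)-w(e))$ and $\tilde S_\le:=\{S(e): e\in\tilde E_\le\}$; using a linear-time selection algorithm, find the $N$-th largest element $\tilde S_\le^N$ of $\tilde S_\le$; put $\tilde E_N:=\{e\in\tilde E_\le: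 S(e)\ge\tilde S_\le^N\}$; put $\tilde w(e):=u(e)$ for $e\in\tilde E_N$ and $\tilde w(e):=w(e)$ for $e\in E\setminus\tilde E_N$. 3. Otherwise put $\tilde w(e):=u(e)$ if $c(e)\le K$ and $\tilde w(e):=w(e)$ if $c(e)>K$. 4. Return $[\tilde w,\tilde w(T)]$.
   Formalization: Ties among the values S(e) are broken by a fixed order of the edges (with ties the algorithm as written can change more than N edges and be infeasible); for N = 0 no edge is raised; optimality is claimed when a feasible vector exists (for K < 0 there is none). *)

theory Defs
  imports
    Complex_Main
    "HOL-Library.Product_Lexorder"
    "HOL-Library.Time_Functions"
    "Graph_Theory.Graph_Theory"
begin

section \<open>The problem\<close>

text \<open>
  A tree rooted at \<open>s\<close> is given as an out-tree: its edges are directed away from \<open>s\<close>, and every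
  node is reached from \<open>s\<close> by exactly one walk. (The constant \<^const>\<open>tree\<close> of the graph library
  only excludes directed cycles, so it also holds of digraphs that are not trees.)
\<close>

locale rooted_tree = fin_digraph G for G :: "('v, 'e) pre_digraph" +
  fixes s :: 'v
  assumes root_in_verts: "s \<in> verts G"
    and unique_walk: "\<And>v. v \<in> verts G \<Longrightarrow> \<exists>!p. awalk s p v"

locale sdiptc = rooted_tree G s for G :: "('v, 'e::linorder) pre_digraph" and s +
  fixes w u c :: "'e \<Rightarrow> real"
  assumes arcs_nonempty: "arcs G \<noteq> {}"
    and w_nonneg: "\<And>e. e \<in> arcs G \<Longrightarrow> 0 \<le> w e"
    and w_le_u: "\<And>e. e \<in> arcs G \<Longrightarrow> w e \<le> u e"
    and c_pos: "\<And>e. e \<in> arcs G \<Longrightarrow> 0 < c e"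
begin

definition H :: "real \<Rightarrow> real \<Rightarrow> real" where
  "H a b = (if a = b then 0 else 1)"

definition leaves :: "'v set" where
  "leaves = {v \<in> verts G. out_arcs G v = {}}"

definition P :: "'v \<Rightarrow> 'e set" where
  "P v = set (THE p. awalk s p v)"

definition L :: "'e \<Rightarrow> 'v set" where
  "L e = {v \<in> leaves. e \<in> P v}"

definition path_weight :: "('e \<Rightarrow> real) \<Rightarrow> 'v \<Rightarrow> real" where
  "path_weight x v = (\<Sum>e\<in>P v. x e)"

definition tree_weight :: "('e \<Rightarrow> real) \<Rightarrow> real" where
  "tree_weight x = (\<Sum>v\<in>leaves. path_weight x v)"

definition feasible :: "real \<Rightarrow> nat \<Rightarrow> ('e \<Rightarrow> real) \<Rightarrow> bool" where
  "feasible K N x \<longleftrightarrow>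
     (MAX e\<in>arcs G. c e * H (x e) (w e)) \<le> K \<and>
     (\<Sum>e\<in>arcs G. H (x e) (w e)) \<le> real N \<and>
     (\<forall>e\<in>arcs G. w e \<le> x e \<and> x e \<le> u e)"

definition optimal :: "real \<Rightarrow> nat \<Rightarrow> ('e \<Rightarrow> real) \<Rightarrow> bool" where
  "optimal K N x \<longleftrightarrow>
     feasible K N x \<and> (\<forall>y. feasible K N y \<longrightarrow> tree_weight y \<le> tree_weight x)"


section \<open>Algorithm A on the rooted tree\<close>

definition S :: "'e \<Rightarrow> real" where
  "S e = real (card (L e)) * (u e - w e)"

definition E_le :: "real \<Rightarrow> 'e set" where
  "E_le K = {e \<in> arcs G. c e \<le> K}"

text \<open>
  The values \<^term>\<open>S e\<close> of different edges may coincide. Then the set of all edges whose value is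
  at least the \<open>N\<close>-th largest value can have more than \<open>N\<close> elements, and raising all of them
  need not be feasible. Ties are therefore broken by the order of the edges: the values
  are compared as pairs \<^term>\<open>(S e, e)\<close>, lexicographically. If the values of the edges in
  \<^term>\<open>E_le K\<close> are pairwise distinct, this is the comparison of the values themselves.
\<close>

definition S_key :: "'e \<Rightarrow> real \<times> 'e" where
  "S_key e = (S e, e)"

text \<open>The \<open>N\<close>-th largest element, for \<open>1 \<le> N \<le> card A\<close>.\<close>

definition nth_largest :: "nat \<Rightarrow> (real \<times> 'e) set \<Rightarrow> real \<times> 'e" where
  "nth_largest N A = rev (sorted_list_of_set A) ! (N - 1)"

text \<open>For \<open>N = 0\<close>, where there is no \<open>N\<close>-th largest element, no edge is selected.\<close>

definition E_N :: "real \<Rightarrow> nat \<Rightarrow> 'e set" where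
  "E_N K N = (if N = 0 then {}
              else {e \<in> E_le K. nth_largest N (S_key ` E_le K) \<le> S_key e})"

definition output_weight :: "real \<Rightarrow> nat \<Rightarrow> 'e \<Rightarrow> real" where
  "output_weight K N e =
     (if N < card (E_le K) then (if e \<in> E_N K N then u e else w e)
      else (if c e \<le> K then u e else w e))"

end


section \<open>Implementation and running time\<close>

text \<open>
  For each function \<open>f\<close> of the implementation, \<open>T_f\<close> is its number of steps, in the convention of
  \<^theory>\<open>HOL-Library.Time_Commands\<close>: every call of a recursive function counts 1 plus the steps of
  the calls in its body; constructors, case distinctions, and arithmetic operations and comparisons
  on numbers, on edges and on pairs of these are primitive. Non-recursive functions that are
  evaluated once per list element are counted as 1 step.
\<close>

subsection \<open>Linear-time selection\<close>

fun insert_sorted :: "'a::linorder \<Rightarrow> 'a list \<Rightarrow> 'a list" where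
  "insert_sorted x [] = [x]"
| "insert_sorted x (y # ys) = (if x \<le> y then x # y # ys else y # insert_sorted x ys)"

fun T_insert_sorted :: "'a::linorder \<Rightarrow> 'a list \<Rightarrow> nat" where
  "T_insert_sorted x [] = 1"
| "T_insert_sorted x (y # ys) = (if x \<le> y then 0 else T_insert_sorted x ys) + 1"

fun insertion_sort :: "'a::linorder list \<Rightarrow> 'a list" where
  "insertion_sort [] = []"
| "insertion_sort (x # xs) = insert_sorted x (insertion_sort xs)"

fun T_insertion_sort :: "'a::linorder list \<Rightarrow> nat" where
  "T_insertion_sort [] = 1"
| "T_insertion_sort (x # xs) =
     T_insertion_sort xs + T_insert_sorted x (insertion_sort xs) + 1"

text \<open>The medians of the consecutive groups of five; fewer than five left-over elements are ignored.\<close>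

fun medians :: "'a::linorder list \<Rightarrow> 'a list" where
  "medians (x1 # x2 # x3 # x4 # x5 # xs) =
     insertion_sort [x1, x2, x3, x4, x5] ! 2 # medians xs"
| "medians xs = []"

fun T_medians :: "'a::linorder list \<Rightarrow> nat" where
  "T_medians (x1 # x2 # x3 # x4 # x5 # xs) =
     T_insertion_sort [x1, x2, x3, x4, x5] + T_nth (insertion_sort [x1, x2, x3, x4, x5]) 2 +
     T_medians xs + 1"
| "T_medians xs = 1"

fun split3 :: "'a::linorder \<Rightarrow> 'a list \<Rightarrow> 'a list \<times> 'a list \<times> 'a list" where
  "split3 m [] = ([], [], [])"
| "split3 m (x # xs) =
     (let (ls, es, gs) = split3 m xs
      in if x < m then (x # ls, es, gs) else if x = m then (ls, x # es, gs) else (ls, es, x # gs))"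

fun T_split3 :: "'a::linorder \<Rightarrow> 'a list \<Rightarrow> nat" where
  "T_split3 m [] = 1"
| "T_split3 m (x # xs) = T_split3 m xs + 1"

lemma split3_filter:
  "split3 m xs = (filter (\<lambda>x. x < m) xs, filter (\<lambda>x. x = m) xs, filter (\<lambda>x. m < x) xs)"
  by (induction xs) auto

lemma length_split3:
  "split3 m xs = (ls, es, gs) \<Longrightarrow> length xs = length ls + length es + length gs"
  by (induction xs arbitrary: ls es gs) (auto simp: Let_def split: prod.splits if_splits)

lemma set_insertion_sort: "set (insertion_sort xs) = set xs"
proof -
  have *: "set (insert_sorted x ys) = insert x (set ys)" for x :: 'a and ys
    by (induction ys) auto
  show ?thesis by (induction xs) (auto simp: *)
qed

lemma length_insertion_sort: "length (insertion_sort xs) = length xs"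
proof -
  have *: "length (insert_sorted x ys) = Suc (length ys)" for x :: 'a and ys
    by (induction ys) auto
  show ?thesis by (induction xs) (auto simp: *)
qed

lemma length_medians: "length (medians xs) = length xs div 5"
  by (induction xs rule: medians.induct) auto

lemma set_medians: "set (medians xs) \<subseteq> set xs"
proof (induction xs rule: medians.induct)
  case (1 x1 x2 x3 x4 x5 xs)
  have "insertion_sort [x1, x2, x3, x4, x5] ! 2 \<in> set (insertion_sort [x1, x2, x3, x4, x5])"
    by (rule nth_mem) (simp only: length_insertion_sort, simp)
  hence "insertion_sort [x1, x2, x3, x4, x5] ! 2 \<in> set [x1, x2, x3, x4, x5]"
    by (simp only: set_insertion_sort)
  moreover have "set (medians (x1 # x2 # x3 # x4 # x5 # xs)) =
      insert (insertion_sort [x1, x2, x3, x4, x5] ! 2) (set (medians xs))"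
    by (simp only: medians.simps list.set)
  ultimately show ?case using 1 by auto
qed auto

text \<open>\<open>select k xs\<close> is the \<open>k\<close>-th smallest element of \<open>xs\<close>, counted from 0 and with multiplicity.\<close>

function select :: "nat \<Rightarrow> 'a::linorder list \<Rightarrow> 'a" where
  "select k xs =
     (let n = length xs
      in if n \<le> 50 then insertion_sort xs ! k
         else let m = select (n div 10) (medians xs);
                  (ls, es, gs) = split3 m xs;
                  nl = length ls;
                  ne = length es
              in if k < nl then select k ls
                 else if k < nl + ne then m
                 else select (k - nl - ne) gs)"
  by auto

lemma select_in_set_aux:
  assumes "select_dom (k, xs)" and "k < length xs"
  shows "select k xs \<in> set xs"
  using assms
proof (induction rule: select.pinduct)
  case (1 k xs)
  show ?case
  proof (cases "length xs \<le> 50")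
    case True
    have "insertion_sort xs ! k \<in> set (insertion_sort xs)"
      using "1.prems" by (intro nth_mem) (simp add: length_insertion_sort)
    thus ?thesis
      using True by (subst select.psimps[OF "1.hyps"]) (simp add: set_insertion_sort)
  next
    case False
    define m where "m = select (length xs div 10) (medians xs)"
    define ls es gs where "ls = filter (\<lambda>x. x < m) xs" and "es = filter (\<lambda>x. x = m) xs"
      and "gs = filter (\<lambda>x. m < x) xs"
    note defs = m_def ls_def es_def gs_def
    have split: "(ls, es, gs) = split3 m xs"
      by (simp add: split3_filter defs)
    have len: "length xs = length ls + length es + length gs"
      by (rule length_split3[OF split[symmetric]])
    have "m \<in> set (medians xs)"
      unfolding m_def by (rule "1.IH"(1)[OF refl False]) (use False in \<open>simp add: length_medians\<close>)
    hence m: "m \<in> set xs"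
      using set_medians by blast
    have less: "select k ls \<in> set ls" if "k < length ls"
      using "1.IH"(2)[OF refl False m_def split refl refl refl refl] that by blast
    have greater: "select (k - length ls - length es) gs \<in> set gs"
      if "\<not> k < length ls" "\<not> k < length ls + length es"
      using "1.IH"(3)[OF refl False m_def split refl refl refl refl] that len "1.prems" by simp
    have "select k xs =
        (if k < length ls then select k ls
         else if k < length ls + length es then m
         else select (k - length ls - length es) gs)"
      using False
      by (subst select.psimps[OF "1.hyps"]) (simp add: Let_def flip: m_def split)
    thus ?thesis
      using less greater m by (auto simp: ls_def gs_def)
  qed
qed

lemma select_all_dom: "All select_dom"
proof (relation "measure (length \<circ> snd)", safe)
  fix k :: nat and xs :: "'a list"
  assume "\<not> length xs \<le> 50"
  thus "((length xs div 10, medians xs), k, xs) \<in> measure (length \<circ> snd)"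
    by (simp add: length_medians)
next
  fix k :: nat and xs ls es gs :: "'a list"
  define m where "m = select (length xs div 10) (medians xs)"
  assume A: "\<not> length xs \<le> 50" "(ls, es, gs) = split3 (select (length xs div 10) (medians xs)) xs"
    "select_dom (length xs div 10, medians xs)"
  have "m \<in> set (medians xs)"
    unfolding m_def by (rule select_in_set_aux[OF A(3)]) (use A(1) in \<open>simp add: length_medians\<close>)
  hence "m \<in> set xs"
    using set_medians by blast
  thus "((k, ls), k, xs) \<in> measure (length \<circ> snd)"
    and "((k - length ls - length es, gs), k, xs) \<in> measure (length \<circ> snd)"
    using A(2) by (auto simp: split3_filter m_def intro!: length_filter_less)
qed

termination select by (rule select_all_dom)

declare select.simps [simp del]

lemma select_in_set: "k < length xs \<Longrightarrow> select k xs \<in> set xs"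
  using select_in_set_aux select_all_dom by blast

function T_select :: "nat \<Rightarrow> 'a::linorder list \<Rightarrow> nat" where
  "T_select k xs =
     (let n = length xs
      in T_length xs +
         (if n \<le> 50 then T_insertion_sort xs + T_nth (insertion_sort xs) k
          else let m = select (n div 10) (medians xs);
                   (ls, es, gs) = split3 m xs;
                   nl = length ls;
                   ne = length es
               in T_medians xs + T_select (n div 10) (medians xs) + T_split3 m xs +
                  T_length ls + T_length es +
                  (if k < nl then T_select k ls
                   else if k < nl + ne then 0
                   else T_select (k - nl - ne) gs)) + 1)"
  by auto
termination
proof (relation "measure (length \<circ> snd)", goal_cases)
  case 1
  show ?case by simp
next
  case (2 k xs n)
  thus ?case by (simp add: length_medians)
next
  case (3 k xs n m a ls b es gs nl ne)
  hence "m \<in> set (medians xs)"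
    using select_in_set[of "n div 10" "medians xs"] by (simp add: length_medians)
  hence "m \<in> set xs" using set_medians by blast
  thus ?case using 3 by (auto simp: split3_filter intro!: length_filter_less)
next
  case (4 k xs n m a ls b es gs nl ne)
  hence "m \<in> set (medians xs)"
    using select_in_set[of "n div 10" "medians xs"] by (simp add: length_medians)
  hence "m \<in> set xs" using set_medians by blast
  thus ?case using 4 by (auto simp: split3_filter intro!: length_filter_less)
qed

declare T_select.simps [simp del]


subsection \<open>The input\<close>

text \<open>
  The input is the linked left-child/right-sibling representation of the rooted tree. A value of
  type \<open>'e arc_list\<close> lists edges that leave one common node; \<open>Arc e a b d t t'\<close> is the edge \<open>e\<close>
  with weight \<open>a\<close>, bound \<open>b\<close> and cost \<open>d\<close>, where \<open>t\<close> lists the edges that leave the lower end of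
  \<open>e\<close> and \<open>t'\<close> contains the remaining siblings of \<open>e\<close>.
\<close>

datatype 'e arc_list = No_Arc | Arc 'e real real real "'e arc_list" "'e arc_list"

context sdiptc
begin

primrec lists_arcs :: "'e arc_list \<Rightarrow> 'e set \<Rightarrow> bool" where
  "lists_arcs No_Arc A \<longleftrightarrow> A = {}"
| "lists_arcs (Arc e a b d t t') A \<longleftrightarrow>
     e \<in> A \<and> a = w e \<and> b = u e \<and> d = c e \<and>
     lists_arcs t (out_arcs G (head G e)) \<and> lists_arcs t' (A - {e})"

definition represents :: "'e arc_list \<Rightarrow> bool" where
  "represents t \<longleftrightarrow> lists_arcs t (out_arcs G s)"

lemma ex_represents: "\<exists>t. represents t"
proof -
  have len: "length p < card (verts G)" if "awalk s p v" for p v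
  proof -
    have "v \<in> verts G" using that by auto
    moreover have "awalk s (awalk_to_apath p) v"
      using apath_awalk_to_apath[OF that] by (rule awalkI_apath)
    ultimately have "awalk_to_apath p = p"
      using unique_walk that by blast
    hence "apath s p v"
      using apath_awalk_to_apath[OF that] by simp
    thus ?thesis
      by (rule length_apath_less)
  qed
  have "\<exists>t. lists_arcs t A"
    if "awalk s p v" "A \<subseteq> out_arcs G v" for p v A
    using that
  proof (induction "card (verts G) - length p" arbitrary: p v A rule: less_induct)
    case less
    have "finite A"
      using less.prems(2) finite_out_arcs finite_subset by blast
    thus ?case using less.prems(2)
    proof (induction A rule: finite_induct)
      case empty
      show ?case by (rule exI[of _ No_Arc]) simp
    next
      case (insert e A)
      then obtain t' where t': "lists_arcs t' A" by auto
      have e: "e \<in> arcs G" "tail G e = v" using insert.prems by auto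
      have walk: "awalk s (p @ [e]) (head G e)"
        using less.prems(1) e arc_implies_awalk[OF e(1)] by (auto intro: awalk_appendI)
      have "card (verts G) - length (p @ [e]) < card (verts G) - length p"
        using len[OF less.prems(1)] by simp
      from less.hyps[OF this walk subset_refl]
      obtain t where "lists_arcs t (out_arcs G (head G e))" by blast
      with t' have "lists_arcs (Arc e (w e) (u e) (c e) t t') (insert e A)"
        using insert.hyps by simp
      thus ?case by blast
    qed
  qed
  moreover have "awalk s [] s"
    using root_in_verts by (simp add: awalk_Nil_iff)
  ultimately show ?thesis
    unfolding represents_def by blast
qed

end


subsection \<open>The program\<close>

text \<open>An edge with its number of leaves, weight, bound and cost.\<close>

datatype 'e item = Item (edge: 'e) (leaf_count: nat) (weight: real) (bound: real) (cost: real)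

text \<open>\<open>annotate t acc\<close> returns the number of leaves below the edges listed in \<open>t\<close>, and adds the
  items of all edges in \<open>t\<close> to \<open>acc\<close>. A count of 0 for the edges leaving the lower end of an edge
  means that this end is itself a leaf.\<close>

fun annotate :: "'e arc_list \<Rightarrow> 'e item list \<Rightarrow> nat \<times> 'e item list" where
  "annotate No_Arc acc = (0, acc)"
| "annotate (Arc e a b d t t') acc =
     (let (i, acc1) = annotate t acc;
          (j, acc2) = annotate t' acc1;
          l = (if i = 0 then 1 else i)
      in (l + j, Item e l a b d # acc2))"

fun T_annotate :: "'e arc_list \<Rightarrow> 'e item list \<Rightarrow> nat" where
  "T_annotate No_Arc acc = 1"
| "T_annotate (Arc e a b d t t') acc =
     T_annotate t acc + T_annotate t' (snd (annotate t acc)) + 1"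

definition item_key :: "'e item \<Rightarrow> real \<times> 'e" where
  "item_key i = (real (leaf_count i) * (bound i - weight i), edge i)"

text \<open>Exchanging the order of summation in the objective gives
  \<open>\<Sum>v\<in>leaves. path_weight x v = \<Sum>e. card (L e) * x e\<close>.\<close>

fun sum_items :: "('e item \<Rightarrow> real) \<Rightarrow> 'e item list \<Rightarrow> real" where
  "sum_items x [] = 0"
| "sum_items x (i # is) = real (leaf_count i) * x i + sum_items x is"

fun T_sum_items :: "('e item \<Rightarrow> nat) \<Rightarrow> 'e item list \<Rightarrow> nat" where
  "T_sum_items T_x [] = 1"
| "T_sum_items T_x (i # is) = T_x i + T_sum_items T_x is + 1"

definition algorithm_A :: "'e::linorder arc_list \<Rightarrow> real \<Rightarrow> nat \<Rightarrow> ('e \<times> real) list \<times> real" where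
  "algorithm_A t K N =
     (let is = snd (annotate t []);
          is_le = filter (\<lambda>i. cost i \<le> K) is;
          m = length is_le;
          x = (if N < m then
                 (if N = 0 then weight
                  else let S_N = select (m - N) (map item_key is_le)
                       in (\<lambda>i. if cost i \<le> K \<and> S_N \<le> item_key i then bound i else weight i))
               else (\<lambda>i. if cost i \<le> K then bound i else weight i))
      in (map (\<lambda>i. (edge i, x i)) is, sum_items x is))"

definition T_algorithm_A :: "'e::linorder arc_list \<Rightarrow> real \<Rightarrow> nat \<Rightarrow> nat" where
  "T_algorithm_A t K N =
     (let is = snd (annotate t []);
          is_le = filter (\<lambda>i. cost i \<le> K) is;
          m = length is_le
      in T_annotate t [] + T_filter (\<lambda>_. 1) is + T_length is_le +
         (if N < m \<and> N \<noteq> 0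
          then T_map (\<lambda>_. 1) is_le + T_select (m - N) (map item_key is_le)
          else 0) +
         T_map (\<lambda>_. 1) is + T_sum_items (\<lambda>_. 1) is + 1)"

end

theory Submission
  imports Defs
begin

text \<open>
  Exchanging the order of summation, the objective is the sum of \<open>card (L e) * x e\<close> over all edges,
  so raising an edge \<open>e\<close> gains at most \<open>S e\<close>. The edges that a feasible solution changes form a
  subset of \<open>E_le K\<close> with at most \<open>N\<close> elements, hence an optimal solution raises the \<open>N\<close> edges of
  largest \<open>S\<close> in \<open>E_le K\<close>, or all of \<open>E_le K\<close> if there are no more than \<open>N\<close>.

  The sets \<open>L e\<close> are disjoint for siblings, and \<open>L e\<close> is the union of the \<open>L f\<close> for the children \<open>f\<close>
  of \<open>e\<close>, so one traversal computes all their sizes. Selection is linear because the median of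
  medians leaves at most \<open>7 n / 10 + 27 / 10\<close> elements on either side and \<open>1 / 5 + 7 / 10 < 1\<close>.
\<close>

section \<open>Selection\<close>

lemma insertion_sort_eq_sort: "insertion_sort xs = sort xs"
proof -
  have "insert_sorted x ys = insort x ys" for x :: 'a and ys
    by (induction ys) auto
  thus ?thesis
    by (induction xs) (auto simp: sort_key_def)
qed

lemma length_filter_sort: "length (filter Q (sort xs)) = length (filter Q xs)"
  by (metis mset_filter mset_sort size_mset)

lemma length_filter_sort_split:
  "length (filter Q xs) =
    length (filter Q (take j (sort xs))) + length (filter Q (drop j (sort xs)))"
  by (metis append_take_drop_id filter_append length_append length_filter_sort)

text \<open>Produces the three blocks among which \<open>select\<close> chooses. The outer blocks
  are sorted and the middle one is constant, so the concatenation is a sorted permutation of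
  \<open>xs\<close>.\<close>

lemma sort_three_way:
  fixes m :: "'a::linorder"
  shows "sort xs = sort (filter (\<lambda>x. x < m) xs) @ filter (\<lambda>x. x = m) xs @
    sort (filter (\<lambda>x. m < x) xs)"
proof (rule properties_for_sort)
  show "mset (sort (filter (\<lambda>x. x < m) xs) @ filter (\<lambda>x. x = m) xs @
      sort (filter (\<lambda>x. m < x) xs)) = mset xs"
    by (induction xs) auto
  have "sorted (filter (\<lambda>x. x = m) xs)"
    by (induction xs) auto
  thus "sorted (sort (filter (\<lambda>x. x < m) xs) @ filter (\<lambda>x. x = m) xs @
      sort (filter (\<lambda>x. m < x) xs))"
    by (auto simp: sorted_append)
qed

text \<open>Each branch reads position \<open>k\<close> from the block of the three-way split that
  contains it, whatever the pivot \<open>m\<close> is. The quality of the pivot matters only for the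
  running time.\<close>

lemma select_eq_nth_sort: "k < length xs \<Longrightarrow> select k xs = sort xs ! k"
proof (induction k xs rule: select.induct)
  case (1 k xs)
  show ?case
  proof (cases "length xs \<le> 50")
    case True
    thus ?thesis
      by (subst select.simps) (simp add: insertion_sort_eq_sort)
  next
    case False
    define m where "m = select (length xs div 10) (medians xs)"
    define ls es gs where "ls = filter (\<lambda>x. x < m) xs" and "es = filter (\<lambda>x. x = m) xs"
      and "gs = filter (\<lambda>x. m < x) xs"
    have split: "(ls, es, gs) = split3 m xs"
      by (simp add: split3_filter ls_def es_def gs_def)
    have len: "length xs = length ls + length es + length gs"
      by (rule length_split3[OF split[symmetric]])
    have less: "select k ls = sort ls ! k" if "k < length ls"
      using "1.IH"(2)[OF refl False m_def split refl refl refl refl] that by blast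
    have greater: "select (k - length ls - length es) gs = sort gs ! (k - length ls - length es)"
      if "\<not> k < length ls" "\<not> k < length ls + length es"
      using "1.IH"(3)[OF refl False m_def split refl refl refl refl] that len "1.prems" by simp
    have equal: "es ! (k - length ls) = m"
      if "\<not> k < length ls" "k < length ls + length es"
    proof -
      have "es ! (k - length ls) \<in> set es"
        using that by (intro nth_mem) linarith
      thus ?thesis by (simp add: es_def)
    qed
    have "select k xs =
        (if k < length ls then select k ls
         else if k < length ls + length es then m
         else select (k - length ls - length es) gs)"
      using False by (subst select.simps) (simp add: Let_def flip: m_def split)
    also have "\<dots> = (sort ls @ es @ sort gs) ! k"
      using less greater equal by (auto simp: nth_append)
    finally show ?thesis
      by (simp add: ls_def es_def gs_def flip: sort_three_way)
  qed
qed

section \<open>Quality of the median of medians as a pivot\<close>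

lemma filter_le_nth_sort:
  assumes "k < length xs"
  shows "k < length (filter (\<lambda>x. x \<le> sort xs ! k) xs)"
proof -
  have "length (filter (\<lambda>x. x \<le> sort xs ! k) (take (Suc k) (sort xs))) = Suc k"
    using assms by (subst filter_True) (auto simp: in_set_conv_nth intro!: sorted_nth_mono)
  thus ?thesis
    by (subst length_filter_sort_split[of _ xs "Suc k"]) simp
qed

lemma filter_ge_nth_sort:
  assumes "k < length xs"
  shows "length xs - k \<le> length (filter (\<lambda>x. sort xs ! k \<le> x) xs)"
proof -
  have "length (filter (\<lambda>x. sort xs ! k \<le> x) (drop k (sort xs))) = length xs - k"
    using assms by (subst filter_True) (auto simp: in_set_conv_nth intro!: sorted_nth_mono)
  thus ?thesis
    by (subst length_filter_sort_split[of _ xs "k"]) simp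
qed

text \<open>A group of five whose median is at most \<open>m\<close> contributes this median and the
  two elements sorted before it. Left-over elements can only increase the right-hand side.\<close>

lemma filter_medians_le:
  "3 * length (filter (\<lambda>x. x \<le> m) (medians xs)) \<le> length (filter (\<lambda>x. x \<le> m) xs)"
proof (induction xs rule: medians.induct)
  case (1 x1 x2 x3 x4 x5 xs)
  define g where "g = [x1, x2, x3, x4, x5]"
  have "3 \<le> length (filter (\<lambda>x. x \<le> m) g)" if "sort g ! 2 \<le> m"
  proof -
    have "2 < length (filter (\<lambda>x. x \<le> sort g ! 2) g)"
      by (rule filter_le_nth_sort) (simp add: g_def)
    also have "\<dots> \<le> length (filter (\<lambda>x. x \<le> m) g)"
      unfolding length_filter_conv_card using that by (intro card_mono) auto
    finally show ?thesis by simp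
  qed
  moreover have "filter (\<lambda>x. x \<le> m) (x1 # x2 # x3 # x4 # x5 # xs) =
      filter (\<lambda>x. x \<le> m) g @ filter (\<lambda>x. x \<le> m) xs"
    by (simp add: g_def)
  moreover have "medians (x1 # x2 # x3 # x4 # x5 # xs) = sort g ! 2 # medians xs"
    by (simp only: medians.simps insertion_sort_eq_sort g_def)
  ultimately show ?case
    using 1 by (auto simp del: medians.simps)
qed auto

lemma filter_medians_ge:
  "3 * length (filter (\<lambda>x. m \<le> x) (medians xs)) \<le> length (filter (\<lambda>x. m \<le> x) xs)"
proof (induction xs rule: medians.induct)
  case (1 x1 x2 x3 x4 x5 xs)
  define g where "g = [x1, x2, x3, x4, x5]"
  have "3 \<le> length (filter (\<lambda>x. m \<le> x) g)" if "m \<le> sort g ! 2"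
  proof -
    have "length g - 2 \<le> length (filter (\<lambda>x. sort g ! 2 \<le> x) g)"
      by (rule filter_ge_nth_sort) (simp add: g_def)
    also have "\<dots> \<le> length (filter (\<lambda>x. m \<le> x) g)"
      unfolding length_filter_conv_card using that by (intro card_mono) auto
    finally show ?thesis by (simp add: g_def)
  qed
  moreover have "filter (\<lambda>x. m \<le> x) (x1 # x2 # x3 # x4 # x5 # xs) =
      filter (\<lambda>x. m \<le> x) g @ filter (\<lambda>x. m \<le> x) xs"
    by (simp add: g_def)
  moreover have "medians (x1 # x2 # x3 # x4 # x5 # xs) = sort g ! 2 # medians xs"
    by (simp only: medians.simps insertion_sort_eq_sort g_def)
  ultimately show ?case
    using 1 by (auto simp del: medians.simps)
qed auto

text \<open>With \<open>n = length xs\<close>, the pivot has position \<open>n div 10\<close> among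
  the \<open>n div 5\<close> medians, so at least \<open>n div 10\<close> medians are at least
  \<open>m\<close> and at least \<open>n div 10 + 1\<close> are at most \<open>m\<close>; each
  accounts for three elements of \<open>xs\<close>. The 27 is three times 9, the largest rounding
  loss in \<open>10 * (n div 10)\<close>.\<close>

lemma median_of_medians_split:
  assumes "length xs > 50" and m: "m = select (length xs div 10) (medians xs)"
  shows "10 * length (filter (\<lambda>x. x < m) xs) \<le> 7 * length xs + 27"
    and "10 * length (filter (\<lambda>x. m < x) xs) \<le> 7 * length xs + 27"
proof -
  let ?n = "length xs"
  have k: "?n div 10 < length (medians xs)"
    using assms(1) by (simp add: length_medians)
  have m_sort: "m = sort (medians xs) ! (?n div 10)"
    unfolding m by (rule select_eq_nth_sort[OF k])
  have "?n div 5 - ?n div 10 \<le> length (filter (\<lambda>x. m \<le> x) (medians xs))"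
    using filter_ge_nth_sort[OF k] by (simp add: m_sort length_medians)
  hence "3 * (?n div 5 - ?n div 10) \<le> length (filter (\<lambda>x. m \<le> x) xs)"
    using filter_medians_ge[of m xs] by linarith
  moreover have "?n = length (filter (\<lambda>x. x < m) xs) + length (filter (\<lambda>x. m \<le> x) xs)"
    using sum_length_filter_compl[of "\<lambda>x. x < m" xs] by (simp add: not_less)
  ultimately show "10 * length (filter (\<lambda>x. x < m) xs) \<le> 7 * ?n + 27"
    by linarith
  have "?n div 10 < length (filter (\<lambda>x. x \<le> m) (medians xs))"
    using filter_le_nth_sort[OF k] by (simp add: m_sort)
  hence "3 * (?n div 10 + 1) \<le> 3 * length (filter (\<lambda>x. x \<le> m) (medians xs))"
    by simp
  also note filter_medians_le
  finally have "3 * (?n div 10 + 1) \<le> length (filter (\<lambda>x. x \<le> m) xs)" .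
  moreover have "?n = length (filter (\<lambda>x. x \<le> m) xs) + length (filter (\<lambda>x. m < x) xs)"
    using sum_length_filter_compl[of "\<lambda>x. x \<le> m" xs] by (simp add: not_le)
  \<comment> \<open>The additional 1 makes up for rounding:
    \<open>n < 10 * (n div 10 + 1)\<close>.\<close>
  moreover have "10 * b \<le> 7 * n + 27" if "3 * (n div 10 + 1) \<le> a" "n = a + b" for n a b :: nat
    using that dividend_less_times_div[of 10 n] by simp
  ultimately show "10 * length (filter (\<lambda>x. m < x) xs) \<le> 7 * ?n + 27"
    by blast
qed

section \<open>Step counts of selection\<close>

lemma T_insertion_sort_le: "T_insertion_sort xs \<le> (length xs + 1)\<^sup>2"
proof (induction xs)
  case (Cons x xs)
  have "T_insert_sorted y ys \<le> length ys + 1" for y :: 'a and ys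
    by (induction ys) auto
  from this[of x "insertion_sort xs"] Cons show ?case
    by (simp add: length_insertion_sort power2_eq_square)
qed simp

text \<open>A group of five costs at most 36 for sorting, 3 for reading the median and 1 for the
  call, which is 8 per element.\<close>

lemma T_medians_le: "T_medians xs \<le> 8 * length xs + 1"
proof (induction xs rule: medians.induct)
  case (1 x1 x2 x3 x4 x5 xs)
  define g where "g = [x1, x2, x3, x4, x5]"
  have len: "length g = 5"
    by (simp add: g_def)
  have "T_insertion_sort g \<le> 36"
    using T_insertion_sort_le[of g] by (simp add: len)
  moreover have "T_nth (insertion_sort g) 2 = 3"
    by (subst T_nth) (simp_all add: length_insertion_sort len)
  moreover have "T_medians (x1 # x2 # x3 # x4 # x5 # xs) =
      T_insertion_sort g + T_nth (insertion_sort g) 2 + T_medians xs + 1"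
    by (simp only: T_medians.simps g_def)
  ultimately show ?case
    using 1 by (simp del: T_medians.simps)
qed auto

lemma T_split3_eq: "T_split3 m xs = length xs + 1"
  by (induction xs) auto

text \<open>2704 bounds the base case \<open>n \<le> 50\<close>; for \<open>n > 50\<close> the two recursive calls save at least
  \<open>2000 * (n - 27) / 10\<close>, which pays for the second additive constant and the linear work.\<close>

lemma T_select_le: "k < length xs \<Longrightarrow> T_select k xs \<le> 2000 * length xs + 2704"
proof (induction k xs rule: T_select.induct)
  case (1 k xs)
  show ?case
  proof (cases "length xs \<le> 50")
    case True
    have "(length xs + 1)\<^sup>2 \<le> 51\<^sup>2"
      using True by (intro power_mono) auto
    thus ?thesis
      using True "1.prems" T_insertion_sort_le[of xs]
      by (subst T_select.simps) (simp add: Let_def T_length T_nth length_insertion_sort)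
  next
    case False
    define m where "m = select (length xs div 10) (medians xs)"
    define ls es gs where "ls = filter (\<lambda>x. x < m) xs" and "es = filter (\<lambda>x. x = m) xs"
      and "gs = filter (\<lambda>x. m < x) xs"
    have split: "(ls, es, gs) = split3 m xs"
      by (simp add: split3_filter ls_def es_def gs_def)
    have len: "length xs = length ls + length es + length gs"
      by (rule length_split3[OF split[symmetric]])
    have meds: "T_select (length xs div 10) (medians xs) \<le> 2000 * (length xs div 5) + 2704"
      using "1.IH"(1)[OF refl False m_def split refl refl refl refl] False by (simp add: length_medians)
    have less: "T_select k ls \<le> 2000 * length ls + 2704" if "k < length ls"
      using "1.IH"(2)[OF refl False m_def split refl refl refl refl] that by blast
    have greater: "T_select (k - length ls - length es) gs \<le> 2000 * length gs + 2704"
      if "\<not> k < length ls" "\<not> k < length ls + length es"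
      using "1.IH"(3)[OF refl False m_def split refl refl refl refl] that len "1.prems" by simp
    define r where "r = (if k < length ls then T_select k ls
         else if k < length ls + length es then 0
         else T_select (k - length ls - length es) gs)"
    \<comment> \<open>Scaled by ten, so that the split bound applies without division; 27040 is ten
      times 2704.\<close>
    have "10 * r \<le> 2000 * (7 * length xs + 27) + 27040"
      using less greater median_of_medians_split[OF _ m_def] False
      by (auto simp: r_def ls_def gs_def)
    moreover have "T_select k xs = T_length xs + T_medians xs +
        T_select (length xs div 10) (medians xs) + T_split3 m xs + T_length ls + T_length es + r + 1"
      using False by (subst T_select.simps) (simp add: Let_def r_def flip: m_def split)
    ultimately show ?thesis
      using False meds T_medians_le[of xs] len by (simp add: T_length T_split3_eq)
  qed
qed


section \<open>Root-leaf paths\<close>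

context rooted_tree
begin

text \<open>The walk behind \<open>P v\<close>, kept as a list: the arguments below compare
  prefixes, which the set \<open>P v\<close> forgets.\<close>

definition root_walk :: "'v \<Rightarrow> 'e list" where
  "root_walk v = (THE p. awalk s p v)"

lemma root_walk_eqI: "awalk s p v \<Longrightarrow> root_walk v = p"
  unfolding root_walk_def using unique_walk[of v] awalk_last_in_verts by blast

lemma awalk_root_walk: "v \<in> verts G \<Longrightarrow> awalk s (root_walk v) v"
  using unique_walk[of v] root_walk_eqI by blast

lemma root_walk_head:
  assumes "e \<in> arcs G"
  shows "root_walk (head G e) = root_walk (tail G e) @ [e]"
  by (rule root_walk_eqI, rule awalk_appendI[OF awalk_root_walk arc_implies_awalk])
    (use assms in auto)

text \<open>The part of the walk before \<open>e\<close> is itself a walk from the root to the tail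
  of \<open>e\<close>, so by uniqueness it is the root walk of that tail.\<close>

lemma in_root_walk_decomp:
  assumes "v \<in> verts G" "e \<in> set (root_walk v)"
  shows "\<exists>q. root_walk v = root_walk (tail G e) @ e # q \<and> awalk (head G e) q v"
proof -
  obtain p q where pq: "root_walk v = p @ e # q"
    using assms(2) by (auto dest: split_list)
  have "awalk s (p @ e # q) v"
    using awalk_root_walk[OF assms(1)] by (simp add: pq)
  hence "awalk s p (tail G e)" "awalk (head G e) q v"
    by (auto simp: awalk_Cons_iff)
  with pq show ?thesis
    using root_walk_eqI by auto
qed

end

context sdiptc
begin

lemma P_eq_root_walk: "P v = set (root_walk v)"
  by (simp add: P_def root_walk_def)

lemma on_path_decomp:
  assumes "v \<in> verts G" "e \<in> P v"
  shows "\<exists>q. root_walk v = root_walk (tail G e) @ e # q \<and> awalk (head G e) q v"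
  using in_root_walk_decomp assms by (simp add: P_eq_root_walk)

lemma P_subset_arcs: "v \<in> verts G \<Longrightarrow> P v \<subseteq> arcs G"
  using awalk_root_walk[of v] by (auto simp: P_eq_root_walk awalk_def)

lemma P_head: "e \<in> arcs G \<Longrightarrow> P (head G e) = insert e (P (tail G e))"
  by (simp add: P_eq_root_walk root_walk_head)

text \<open>Both edges come directly after the root walk of their common tail, hence at the same
  position of the walk to \<open>v\<close>.\<close>

lemma siblings_on_path_eq:
  assumes "v \<in> verts G" "e \<in> P v" "f \<in> P v" "tail G e = tail G f"
  shows "e = f"
proof -
  obtain q where "root_walk v = root_walk (tail G e) @ e # q"
    using on_path_decomp assms(1,2) by blast
  moreover obtain r where "root_walk v = root_walk (tail G f) @ f # r"
    using on_path_decomp assms(1,3) by blast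
  ultimately have "root_walk (tail G f) @ e # q = root_walk (tail G f) @ f # r"
    unfolding assms(4) by (rule trans[OF sym])
  thus ?thesis by simp
qed

lemma path_continues:
  assumes "v \<in> verts G" "e \<in> P v" "v \<noteq> head G e"
  shows "\<exists>f \<in> out_arcs G (head G e). f \<in> P v"
proof -
  obtain q where q: "root_walk v = root_walk (tail G e) @ e # q" "awalk (head G e) q v"
    using on_path_decomp assms(1,2) by blast
  then obtain f r where "q = f # r"
    using assms(3) by (cases q) (auto simp: awalk_Nil_iff)
  thus ?thesis
    using q by (auto simp: P_eq_root_walk awalk_Cons_iff)
qed

lemma parent_on_path:
  assumes "v \<in> verts G" "e \<in> arcs G" "f \<in> out_arcs G (head G e)" "f \<in> P v"
  shows "e \<in> P v"
proof -
  obtain q where "root_walk v = root_walk (tail G f) @ f # q"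
    using on_path_decomp assms(1,4) by blast
  thus ?thesis
    using assms(2,3) by (simp add: P_eq_root_walk root_walk_head)
qed

text \<open>Otherwise the root walk of \<open>v\<close> would be a proper prefix of itself.\<close>

lemma out_arc_notin_P:
  assumes "v \<in> verts G" "f \<in> out_arcs G v"
  shows "f \<notin> P v"
proof
  assume "f \<in> P v"
  then obtain q where "root_walk v = root_walk (tail G f) @ f # q"
    using on_path_decomp[OF assms(1)] by blast
  thus False
    using assms(2) by simp
qed

section \<open>Leaves below an edge\<close>

lemma finite_leaves: "finite leaves"
  unfolding leaves_def by simp

lemma finite_L: "finite (L e)"
  unfolding L_def using finite_leaves by simp

lemma L_leaf_arc:
  assumes "e \<in> arcs G" "out_arcs G (head G e) = {}"
  shows "L e = {head G e}"
  using assms path_continues by (fastforce simp: L_def leaves_def P_head)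

text \<open>The head of \<open>e\<close> is not a leaf, so a path to a leaf through \<open>e\<close>
  continues with a child of \<open>e\<close>; conversely, a path through a child has passed through
  \<open>e\<close>.\<close>

lemma L_inner_arc:
  assumes "e \<in> arcs G" "out_arcs G (head G e) \<noteq> {}"
  shows "L e = (\<Union>f \<in> out_arcs G (head G e). L f)"
proof
  show "L e \<subseteq> (\<Union>f \<in> out_arcs G (head G e). L f)"
  proof
    fix v assume v: "v \<in> L e"
    hence "v \<noteq> head G e"
      using assms(2) by (auto simp: L_def leaves_def)
    thus "v \<in> (\<Union>f \<in> out_arcs G (head G e). L f)"
      using v path_continues[of v e] by (auto simp: L_def leaves_def)
  qed
  show "(\<Union>f \<in> out_arcs G (head G e). L f) \<subseteq> L e"
    using assms(1) parent_on_path by (auto simp: L_def leaves_def)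
qed

lemma card_UN_L:
  assumes "A \<subseteq> out_arcs G v"
  shows "card (\<Union>e\<in>A. L e) = (\<Sum>e\<in>A. card (L e))"
proof (rule card_UN_disjoint)
  show "finite A"
    using assms finite_out_arcs finite_subset by blast
  show "\<forall>i\<in>A. \<forall>j\<in>A. i \<noteq> j \<longrightarrow> L i \<inter> L j = {}"
  proof (intro ballI impI, rule ccontr)
    fix i j assume ij: "i \<in> A" "j \<in> A" "i \<noteq> j" "L i \<inter> L j \<noteq> {}"
    then obtain x where "x \<in> verts G" "i \<in> P x" "j \<in> P x"
      by (auto simp: L_def leaves_def)
    moreover have "tail G i = tail G j"
      using subsetD[OF assms ij(1)] subsetD[OF assms ij(2)] by simp
    ultimately show False
      using siblings_on_path_eq ij(3) by blast
  qed
qed (simp add: finite_L)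

lemma tree_weight_eq: "tree_weight x = (\<Sum>e\<in>arcs G. real (card (L e)) * x e)"
proof -
  \<comment> \<open>Extending the inner sum by zeros makes its range independent of
    \<open>v\<close>, so that the two sums can be swapped.\<close>
  have "tree_weight x = (\<Sum>v\<in>leaves. \<Sum>e\<in>arcs G. if e \<in> P v then x e else 0)"
    unfolding tree_weight_def path_weight_def
  proof (rule sum.cong[OF refl])
    fix v assume "v \<in> leaves"
    hence "P v \<subseteq> arcs G"
      using P_subset_arcs by (auto simp: leaves_def)
    hence "P v = arcs G \<inter> P v" by blast
    thus "(\<Sum>e\<in>P v. x e) = (\<Sum>e\<in>arcs G. if e \<in> P v then x e else 0)"
      using sum.inter_restrict[of "arcs G" x "P v"] by simp
  qed
  also have "\<dots> = (\<Sum>e\<in>arcs G. \<Sum>v\<in>leaves. if e \<in> P v then x e else 0)"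
    by (rule sum.swap)
  also have "\<dots> = (\<Sum>e\<in>arcs G. real (card (L e)) * x e)"
    by (intro sum.cong refl)
      (simp add: L_def finite_leaves flip: sum.inter_filter)
  finally show ?thesis .
qed


section \<open>The annotated edge list\<close>

definition item_of :: "'e \<Rightarrow> 'e item" where
  "item_of e = Item e (card (L e)) (w e) (u e) (c e)"

lemma item_of_sel [simp]:
  "edge (item_of e) = e" "leaf_count (item_of e) = card (L e)" "weight (item_of e) = w e"
  "bound (item_of e) = u e" "cost (item_of e) = c e"
  by (simp_all add: item_of_def)

lemma item_key_item_of: "item_key (item_of e) = S_key e"
  by (simp add: item_key_def S_key_def S_def)

text \<open>For edges \<open>A\<close> leaving one node, these are the edges of \<open>A\<close> and
  all their descendants. The walk to the head of \<open>e\<close> is used because it contains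
  \<open>e\<close> itself.\<close>

definition arcs_below :: "'e set \<Rightarrow> 'e set" where
  "arcs_below A = {e \<in> arcs G. P (head G e) \<inter> A \<noteq> {}}"

lemma arcs_below_insert: "arcs_below (insert e A) = arcs_below {e} \<union> arcs_below A"
  by (auto simp: arcs_below_def)

lemma arcs_below_siblings_disjoint:
  assumes "A \<subseteq> out_arcs G v" "e \<in> out_arcs G v" "e \<notin> A"
  shows "arcs_below {e} \<inter> arcs_below A = {}"
proof (rule ccontr)
  assume "arcs_below {e} \<inter> arcs_below A \<noteq> {}"
  then obtain f a where f: "f \<in> arcs G" "e \<in> P (head G f)" "a \<in> P (head G f)" "a \<in> A"
    by (auto simp: arcs_below_def)
  moreover have "tail G e = tail G a"
    using f(4) assms(1,2) by auto
  ultimately have "e = a"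
    using siblings_on_path_eq[of "head G f" e a] by simp
  with f(4) assms(3) show False by simp
qed

lemma arcs_below_arc:
  assumes "e \<in> arcs G"
  shows "arcs_below {e} = insert e (arcs_below (out_arcs G (head G e)))"
proof (intro equalityI subsetI)
  fix f assume f: "f \<in> arcs_below {e}"
  show "f \<in> insert e (arcs_below (out_arcs G (head G e)))"
  proof (cases "head G f = head G e")
    case True
    \<comment> \<open>Equal heads have equal root walks, and comparing the last edges gives
      \<open>f = e\<close>.\<close>
    have "root_walk (tail G f) @ [f] = root_walk (tail G e) @ [e]"
      using root_walk_head[of f] root_walk_head[OF assms] f True by (simp add: arcs_below_def)
    thus ?thesis by simp
  next
    case False
    thus ?thesis
      using path_continues[of "head G f" e] f by (auto simp: arcs_below_def)
  qed
next
  fix f assume "f \<in> insert e (arcs_below (out_arcs G (head G e)))"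
  thus "f \<in> arcs_below {e}"
    using assms parent_on_path[OF _ assms] by (fastforce simp: arcs_below_def P_head)
qed

lemma notin_arcs_below_head:
  assumes "e \<in> arcs G"
  shows "e \<notin> arcs_below (out_arcs G (head G e))"
  using out_arc_notin_P[of "head G e"] assms by (auto simp: arcs_below_def)

text \<open>The walk to the head of any edge is nonempty, and its first edge leaves the
  root.\<close>

lemma arcs_below_root: "arcs_below (out_arcs G s) = arcs G"
proof -
  have "P (head G e) \<inter> out_arcs G s \<noteq> {}" if e: "e \<in> arcs G" for e
  proof -
    obtain f q where q: "root_walk (head G e) = f # q"
      using root_walk_head[OF e] neq_Nil_conv[of "root_walk (head G e)"] by auto
    have "awalk s (root_walk (head G e)) (head G e)"
      using e by (intro awalk_root_walk) simp
    hence "f \<in> out_arcs G s"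
      by (simp add: q awalk_Cons_iff)
    moreover have "f \<in> P (head G e)"
      by (simp add: P_eq_root_walk q)
    ultimately show ?thesis by blast
  qed
  thus ?thesis
    by (auto simp: arcs_below_def)
qed

text \<open>The induction needs an arbitrary accumulator, because the second recursive call receives
  the result of the first. The positivity clause justifies the test for 0 in
  \<open>annotate\<close>: the count vanishes only if no edge leaves the node.\<close>

lemma annotate_correct:
  assumes "lists_arcs t A" "A \<subseteq> out_arcs G v"
  shows "\<exists>is. annotate t acc = (\<Sum>e\<in>A. card (L e), is @ acc) \<and> distinct (map edge is) \<and>
    set is = item_of ` arcs_below A \<and> (A \<noteq> {} \<longrightarrow> 0 < (\<Sum>e\<in>A. card (L e)))"
  using assms
proof (induction t arbitrary: A v acc)
  case No_Arc
  thus ?case by (simp add: arcs_below_def)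
next
  case (Arc e a b d t t')
  let ?O = "out_arcs G (head G e)" and ?B = "A - {e}"
  have e: "e \<in> A" "e \<in> out_arcs G v" "e \<in> arcs G" and abd: "a = w e" "b = u e" "d = c e"
    and t: "lists_arcs t ?O" and t': "lists_arcs t' ?B" and B: "?B \<subseteq> out_arcs G v"
    using Arc.prems by auto
  obtain is1 where is1: "annotate t acc = (\<Sum>e\<in>?O. card (L e), is1 @ acc)"
    "distinct (map edge is1)" "set is1 = item_of ` arcs_below ?O"
    "?O \<noteq> {} \<longrightarrow> 0 < (\<Sum>e\<in>?O. card (L e))"
    using Arc.IH(1)[OF t subset_refl, of acc] by blast
  obtain is2 where is2: "annotate t' (is1 @ acc) = (\<Sum>e\<in>?B. card (L e), is2 @ is1 @ acc)"
    "distinct (map edge is2)" "set is2 = item_of ` arcs_below ?B"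
    using Arc.IH(2)[OF t' B, of "is1 @ acc"] by blast
  \<comment> \<open>At a leaf the default 1 counts the head of \<open>e\<close>; elsewhere the count
    is positive and equals \<open>card (L e)\<close> by disjointness of the children's leaf
    sets.\<close>
  have l: "(if (\<Sum>e\<in>?O. card (L e)) = 0 then 1 else (\<Sum>e\<in>?O. card (L e))) = card (L e)"
  proof (cases "?O = {}")
    case True
    thus ?thesis using L_leaf_arc[OF e(3)] by simp
  next
    case False
    thus ?thesis
      using L_inner_arc[OF e(3)] card_UN_L[OF subset_refl] is1(4) by simp
  qed
  have finA: "finite A"
    using Arc.prems(2) finite_out_arcs finite_subset by blast
  have sumA: "(\<Sum>e\<in>A. card (L e)) = card (L e) + (\<Sum>e\<in>?B. card (L e))"
    by (rule sum.remove[OF finA e(1)])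
  have "annotate (Arc e a b d t t') acc =
      (\<Sum>e\<in>A. card (L e), (item_of e # is2 @ is1) @ acc)"
    using l by (simp add: is1(1) is2(1) sumA item_of_def abd Let_def del: sum_eq_0_iff)
  moreover have A: "arcs_below A = insert e (arcs_below ?O) \<union> arcs_below ?B"
    using arcs_below_insert[of e ?B] arcs_below_arc[OF e(3)] e(1) by (simp add: insert_absorb)
  have "insert e (arcs_below ?O) \<inter> arcs_below ?B = {}"
    using arcs_below_siblings_disjoint[OF B e(2)] arcs_below_arc[OF e(3)] by simp
  hence "distinct (map edge (item_of e # is2 @ is1))"
    using is1(2,3) is2(2,3) notin_arcs_below_head[OF e(3)] by (auto simp: image_image)
  moreover have "set (item_of e # is2 @ is1) = item_of ` arcs_below A"
    by (auto simp: A is1(3) is2(3))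
  moreover have "0 < card (L e)"
    using l is1(4) by (auto split: if_splits)
  ultimately show ?case
    using sumA by (intro exI[of _ "item_of e # is2 @ is1"]) simp
qed

lemma annotate_represents:
  assumes "represents t"
  shows "distinct (map edge (snd (annotate t [])))" "set (snd (annotate t [])) = item_of ` arcs G"
  using annotate_correct[of t "out_arcs G s" s "[]"] assms arcs_below_root
  by (auto simp: represents_def)

end

text \<open>An \<open>arc_list\<close> is a binary tree: \<open>n\<close> edges come with
  \<open>n + 1\<close> empty lists, hence \<open>2 * n + 1\<close> calls. Each edge adds one item to
  \<open>acc\<close>; the term \<open>2 * length acc\<close> on the left avoids a
  subtraction.\<close>

lemma T_annotate_eq: "T_annotate t acc + 2 * length acc = 2 * length (snd (annotate t acc)) + 1"
proof (induction t arbitrary: acc)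
  case (Arc e a b d t t')
  show ?case
    using Arc.IH(1)[of acc] Arc.IH(2)[of "snd (annotate t acc)"]
    by (simp add: split_beta Let_def)
qed simp


section \<open>Greedy choice\<close>

text \<open>Exchange argument: the common part cancels, \<open>A - B\<close> has at most as many
  elements as \<open>B - A\<close>, and the threshold separates their values. Since it is
  nonnegative, surplus elements of \<open>B\<close> do no harm.\<close>

lemma sum_le_sum_above_threshold:
  fixes f :: "'a \<Rightarrow> real"
  assumes "finite A" "finite B" "card A \<le> card B" "0 \<le> \<theta>"
    and "\<And>a. a \<in> A - B \<Longrightarrow> f a \<le> \<theta>" "\<And>b. b \<in> B - A \<Longrightarrow> \<theta> \<le> f b"
  shows "sum f A \<le> sum f B"
proof -
  have "card (A - B) \<le> card (B - A)"
    using assms(1-3) by (simp add: card_Diff_subset_Int Int_commute)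
  hence "real (card (A - B)) * \<theta> \<le> real (card (B - A)) * \<theta>"
    using assms(4) by (intro mult_right_mono) auto
  moreover have "sum f (A - B) \<le> real (card (A - B)) * \<theta>"
    by (rule sum_bounded_above) (rule assms(5))
  moreover have "real (card (B - A)) * \<theta> \<le> sum f (B - A)"
    by (rule sum_bounded_below) (rule assms(6))
  moreover have "sum f A = sum f (A \<inter> B) + sum f (A - B)" "sum f B = sum f (A \<inter> B) + sum f (B - A)"
    using assms(1,2) by (simp_all add: sum.Int_Diff[of A f B] sum.Int_Diff[of B f A] Int_commute)
  ultimately show ?thesis by linarith
qed

text \<open>The list is strictly increasing, so the elements in question are exactly those at
  positions \<open>k\<close> to \<open>card A - 1\<close>.\<close>

lemma card_above_nth_sorted_list_of_set:
  fixes A :: "'a::linorder set"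
  assumes "finite A" "k < card A"
  shows "card {a \<in> A. sorted_list_of_set A ! k \<le> a} = card A - k"
proof -
  let ?xs = "sorted_list_of_set A"
  have less: "?xs ! i < ?xs ! j" if "i < j" "j < card A" for i j
    using that sorted_wrt_nth_less[OF strict_sorted_list_of_set[of A]] by simp
  have le_iff: "?xs ! k \<le> ?xs ! i \<longleftrightarrow> k \<le> i" if "i < card A" for i
    using less[of i k] less[of k i] that assms(2) by (cases i k rule: linorder_cases) auto
  have "{a \<in> A. ?xs ! k \<le> a} = {a \<in> set ?xs. ?xs ! k \<le> a}"
    using assms(1) by simp
  also have "\<dots> = (!) ?xs ` {k..<card A}"
    using le_iff by (auto simp: in_set_conv_nth image_iff)
  finally have "card {a \<in> A. ?xs ! k \<le> a} = card ((!) ?xs ` {k..<card A})"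
    by simp
  also have "\<dots> = card A - k"
    by (subst card_image) (auto intro!: inj_on_nth)
  finally show ?thesis .
qed

context sdiptc
begin

section \<open>The edges selected by the threshold\<close>

lemma nth_largest_eq:
  assumes "0 < N" "N \<le> card A"
  shows "nth_largest N A = sorted_list_of_set A ! (card A - N)"
  using assms by (simp add: nth_largest_def rev_nth)

lemma inj_S_key: "inj S_key"
  by (auto simp: inj_def S_key_def)

lemma finite_E_le: "finite (E_le K)"
  by (simp add: E_le_def)

text \<open>Injective keys leave no ties, so exactly \<open>N\<close> keys reach the
  \<open>N\<close>-th largest one.\<close>

lemma card_E_N:
  assumes "N < card (E_le K)"
  shows "card (E_N K N) = N"
proof (cases "N = 0")
  case False
  let ?A = "S_key ` E_le K"
  have cA: "card ?A = card (E_le K)"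
    using inj_S_key by (meson card_image inj_on_subset subset_UNIV)
  have "S_key ` E_N K N = {a \<in> ?A. sorted_list_of_set ?A ! (card ?A - N) \<le> a}"
    using False assms by (auto simp: E_N_def nth_largest_eq cA)
  also have "card \<dots> = N"
    using False assms
    by (subst card_above_nth_sorted_list_of_set) (auto simp: cA finite_E_le)
  finally show ?thesis
    using inj_S_key by (metis card_image inj_on_subset subset_UNIV)
qed (simp add: E_N_def)

definition raised :: "real \<Rightarrow> nat \<Rightarrow> 'e set" where
  "raised K N = (if N < card (E_le K) then E_N K N else E_le K)"

lemma raised_subset: "raised K N \<subseteq> E_le K"
  by (auto simp: raised_def E_N_def)

lemma card_raised: "card (raised K N) \<le> N"
  by (simp add: raised_def card_E_N)

lemma output_weight_eq:
  "e \<in> arcs G \<Longrightarrow> output_weight K N e = (if e \<in> raised K N then u e else w e)"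
  by (auto simp: output_weight_def raised_def E_le_def)

lemma S_nonneg: "e \<in> arcs G \<Longrightarrow> 0 \<le> S e"
  using w_le_u by (simp add: S_def)

text \<open>If all of \<open>E_le K\<close> is raised, this is monotonicity of sums of nonnegative
  terms. Otherwise, for \<open>N > 0\<close>, the exchange argument applies with threshold
  \<open>S f\<close>, where \<open>f\<close> is the edge with the \<open>N\<close>-th largest key:
  lexicographic comparison of keys implies comparison of their \<open>S\<close> values.\<close>

lemma raised_optimal:
  assumes "D \<subseteq> E_le K" "card D \<le> N"
  shows "sum S D \<le> sum S (raised K N)"
proof (cases "N < card (E_le K)")
  case False
  thus ?thesis
    using assms(1) S_nonneg by (auto simp: raised_def E_le_def intro!: sum_mono2)
next
  case True
  have fin: "finite D"
    using assms(1) finite_E_le finite_subset by blast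
  show ?thesis
  proof (cases "N = 0")
    case True
    hence "D = {}"
      using assms(2) fin by simp
    thus ?thesis
      using S_nonneg raised_subset by (auto simp: E_le_def intro!: sum_nonneg)
  next
    case False
    let ?A = "S_key ` E_le K"
    have "card ?A = card (E_le K)"
      using inj_S_key by (meson card_image inj_on_subset subset_UNIV)
    hence "nth_largest N ?A \<in> set (sorted_list_of_set ?A)"
      using False True by (subst nth_largest_eq) (auto intro!: nth_mem)
    then obtain f where f: "f \<in> E_le K" "nth_largest N ?A = S_key f"
      using finite_E_le by auto
    have E_N: "E_N K N = {e \<in> E_le K. S_key f \<le> S_key e}"
      using False by (simp add: E_N_def f(2))
    have "sum S D \<le> sum S (E_N K N)"
    proof (rule sum_le_sum_above_threshold)
      show "finite (E_N K N)"
        by (simp add: E_N finite_E_le)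
      show "card D \<le> card (E_N K N)"
        using assms(2) True by (simp add: card_E_N)
      show "0 \<le> S f"
        using f(1) S_nonneg by (simp add: E_le_def)
      show "S a \<le> S f" if "a \<in> D - E_N K N" for a
        using that assms(1) by (auto simp: E_N S_key_def less_eq_prod_def)
      show "S f \<le> S b" if "b \<in> E_N K N - D" for b
        using that by (auto simp: E_N S_key_def less_eq_prod_def)
    qed (fact fin)
    thus ?thesis
      using True by (simp add: raised_def)
  qed
qed

text \<open>\<open>H\<close> is the indicator of a changed edge, so the cost constraint concerns
  only changed edges, apart from \<open>0 \<le> K\<close>: the maximum is over a nonempty set of
  nonnegative terms.\<close>

lemma feasible_iff:
  "feasible K N x \<longleftrightarrow> 0 \<le> K \<and> {e \<in> arcs G. x e \<noteq> w e} \<subseteq> E_le K \<and>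
    card {e \<in> arcs G. x e \<noteq> w e} \<le> N \<and> (\<forall>e\<in>arcs G. w e \<le> x e \<and> x e \<le> u e)"
proof -
  have "(\<Sum>e\<in>arcs G. H (x e) (w e)) = (\<Sum>e\<in>arcs G. if x e \<noteq> w e then 1 else 0)"
    by (intro sum.cong) (auto simp: H_def)
  also have "\<dots> = real (card {e \<in> arcs G. x e \<noteq> w e})"
    by (simp flip: sum.inter_filter)
  finally have count: "(\<Sum>e\<in>arcs G. H (x e) (w e)) = real (card {e \<in> arcs G. x e \<noteq> w e})" .
  have "(MAX e\<in>arcs G. c e * H (x e) (w e)) \<le> K \<longleftrightarrow> (\<forall>e\<in>arcs G. c e * H (x e) (w e) \<le> K)"
    using arcs_nonempty by (subst Max_le_iff) auto
  also have "\<dots> \<longleftrightarrow> 0 \<le> K \<and> {e \<in> arcs G. x e \<noteq> w e} \<subseteq> E_le K"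
  proof
    assume max: "\<forall>e\<in>arcs G. c e * H (x e) (w e) \<le> K"
    obtain e where e: "e \<in> arcs G"
      using arcs_nonempty by blast
    have "0 \<le> c e * H (x e) (w e)"
      using c_pos[OF e] by (simp add: H_def)
    with max e have "0 \<le> K" by force
    with max show "0 \<le> K \<and> {e \<in> arcs G. x e \<noteq> w e} \<subseteq> E_le K"
      by (auto simp: E_le_def H_def split: if_splits)
  qed (auto simp: E_le_def H_def)
  finally show ?thesis
    by (simp add: feasible_def count conj_assoc)
qed

text \<open>The feasible \<open>y0\<close> supplies \<open>0 \<le> K\<close>; for negative
  \<open>K\<close> no weight vector is feasible.\<close>

lemma optimal_output_weight:
  assumes "feasible K N y0"
  shows "optimal K N (output_weight K N)"
  unfolding optimal_def
proof (intro conjI allI impI)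
  let ?x = "output_weight K N"
  \<comment> \<open>Only an inclusion, since a raised edge with \<open>u e = w e\<close> keeps its
    weight.\<close>
  have sub: "{e \<in> arcs G. ?x e \<noteq> w e} \<subseteq> raised K N"
    by (auto simp: output_weight_eq split: if_splits)
  hence "card {e \<in> arcs G. ?x e \<noteq> w e} \<le> card (raised K N)"
    using raised_subset finite_E_le by (intro card_mono) (meson finite_subset)+
  thus "feasible K N ?x"
    using assms sub raised_subset[of K N] card_raised[of K N] w_le_u
    by (auto simp: feasible_iff output_weight_eq)
  have gain: "tree_weight x = (\<Sum>e\<in>arcs G. real (card (L e)) * w e) +
      (\<Sum>e\<in>arcs G. real (card (L e)) * (x e - w e))" for x
    by (simp add: tree_weight_eq algebra_simps flip: sum.distrib)
  have raised: "raised K N \<subseteq> arcs G"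
    using raised_subset[of K N] by (auto simp: E_le_def)
  fix y assume y: "feasible K N y"
  let ?D = "{e \<in> arcs G. y e \<noteq> w e}"
  have "(\<Sum>e\<in>arcs G. real (card (L e)) * (y e - w e)) =
      (\<Sum>e\<in>?D. real (card (L e)) * (y e - w e))"
    by (rule sum.mono_neutral_right) auto
  \<comment> \<open>An increase is at most \<open>u e - w e\<close>; on raised edges the output
    attains this bound.\<close>
  also have "\<dots> \<le> sum S ?D"
    using y by (intro sum_mono) (auto simp: feasible_iff S_def intro!: mult_left_mono)
  also have "\<dots> \<le> sum S (raised K N)"
    using y by (intro raised_optimal) (auto simp: feasible_iff)
  also have "\<dots> = (\<Sum>e\<in>raised K N. real (card (L e)) * (?x e - w e))"
    using raised by (intro sum.cong) (auto simp: S_def output_weight_eq)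
  also have "\<dots> = (\<Sum>e\<in>arcs G. real (card (L e)) * (?x e - w e))"
    using raised by (intro sum.mono_neutral_left) (auto simp: output_weight_eq)
  finally show "tree_weight y \<le> tree_weight ?x"
    by (simp add: gain)
qed


section \<open>Correctness and running time\<close>

lemma cheap_items:
  fixes K :: real
  assumes "represents t"
  defines "is_le \<equiv> filter (\<lambda>i. cost i \<le> K) (snd (annotate t []))"
  shows "length is_le = card (E_le K)" "distinct (map item_key is_le)"
    "set (map item_key is_le) = S_key ` E_le K"
proof -
  note t = annotate_represents[OF assms(1)]
  have set: "set is_le = item_of ` E_le K"
    by (auto simp: is_le_def t(2) E_le_def)
  have dist: "distinct (map edge is_le)"
    using t(1) by (auto simp: is_le_def distinct_map inj_on_def)
  have "set (map edge is_le) = E_le K"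
    by (simp add: set image_image)
  thus "length is_le = card (E_le K)"
    using distinct_card[OF dist] by simp
  \<comment> \<open>The edge can be recovered from its key, so distinct edges give distinct
    keys.\<close>
  have "map edge is_le = map snd (map item_key is_le)"
    by (simp add: item_key_def)
  thus "distinct (map item_key is_le)"
    using dist by (metis distinct_map)
  show "set (map item_key is_le) = S_key ` E_le K"
    by (simp add: set image_image item_key_item_of)
qed

text \<open>The keys are distinct, so sorting their list is the same as listing their set. Counted
  from 0 in increasing order, the \<open>N\<close>-th largest of them has index
  \<open>card (E_le K) - N\<close>.\<close>

lemma select_item_key:
  assumes "represents t" "0 < N" "N < card (E_le K)"
  shows "select (card (E_le K) - N)
      (map item_key (filter (\<lambda>i. cost i \<le> K) (snd (annotate t [])))) =
    nth_largest N (S_key ` E_le K)"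
proof -
  let ?ks = "map item_key (filter (\<lambda>i. cost i \<le> K) (snd (annotate t [])))"
  note ks = cheap_items[OF assms(1), of K]
  have "select (card (E_le K) - N) ?ks = sort ?ks ! (card (E_le K) - N)"
    using assms ks(1) by (intro select_eq_nth_sort) auto
  also have "sort ?ks = sorted_list_of_set (set ?ks)"
    using ks(2) by (simp only: sorted_list_of_set_sort_remdups distinct_remdups_id)
  finally have "select (card (E_le K) - N) ?ks =
      sorted_list_of_set (S_key ` E_le K) ! (card (E_le K) - N)"
    by (simp only: ks(3))
  moreover have "card (S_key ` E_le K) = card (E_le K)"
    using inj_S_key by (meson card_image inj_on_subset subset_UNIV)
  ultimately show ?thesis
    using assms by (simp add: nth_largest_eq)
qed

lemma sum_items_eq_sum_list: "sum_items x is = (\<Sum>i\<leftarrow>is. real (leaf_count i) * x i)"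
  by (induction "is") auto

lemma algorithm_A_correct:
  assumes "represents t" "algorithm_A t K N = (xs, z)"
  shows "distinct (map fst xs)" "set xs = (\<lambda>e. (e, output_weight K N e)) ` arcs G"
    "z = tree_weight (output_weight K N)"
proof -
  note t = annotate_represents[OF assms(1)]
  \<comment> \<open>The weight function of the program, with the result of \<open>select\<close>
    replaced by the element it stands for.\<close>
  define x where "x = (if N < card (E_le K) then
                 (if N = 0 then weight
                  else (\<lambda>i. if cost i \<le> K \<and> nth_largest N (S_key ` E_le K) \<le> item_key i
                            then bound i else weight i))
               else (\<lambda>i. if cost i \<le> K then bound i else weight i))"
  have x: "x (item_of e) = output_weight K N e" if "e \<in> arcs G" for e
    using that by (auto simp: x_def output_weight_def E_N_def E_le_def item_key_item_of)
  have "algorithm_A t K N =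
      (map (\<lambda>i. (edge i, x i)) (snd (annotate t [])), sum_items x (snd (annotate t [])))"
    using cheap_items(1)[OF assms(1), of K] select_item_key[OF assms(1), of N K]
    by (auto simp: algorithm_A_def x_def Let_def)
  hence xs: "xs = map (\<lambda>i. (edge i, x i)) (snd (annotate t []))"
    and z: "z = sum_items x (snd (annotate t []))"
    using assms(2) by auto
  show "distinct (map fst xs)"
    using t(1) by (simp add: xs comp_def)
  show "set xs = (\<lambda>e. (e, output_weight K N e)) ` arcs G"
    using x by (force simp: xs t(2) image_image)
  have "distinct (snd (annotate t []))"
    using t(1) by (simp add: distinct_map)
  hence "z = (\<Sum>i\<in>item_of ` arcs G. real (leaf_count i) * x i)"
    by (simp add: z sum_items_eq_sum_list sum_list_distinct_conv_sum_set t(2))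
  also have "\<dots> = (\<Sum>e\<in>arcs G. real (card (L e)) * x (item_of e))"
    by (subst sum.reindex) (auto simp: inj_on_def dest: arg_cong[of _ _ edge])
  also have "\<dots> = tree_weight (output_weight K N)"
    by (simp add: tree_weight_eq x)
  finally show "z = tree_weight (output_weight K N)" .
qed

lemma T_sum_items_eq: "T_sum_items (\<lambda>_. Suc 0) is = 2 * length is + 1"
  by (induction "is") auto

text \<open>Selection contributes about 2000 per edge and the constant 2704, the remaining passes
  only a few steps per edge. As there is at least one edge, the constants are absorbed, and the
  total stays below 5000 per edge.\<close>

lemma T_algorithm_A_le:
  assumes "represents t"
  shows "T_algorithm_A t K N \<le> 5000 * card (arcs G)"
proof -
  let ?is = "snd (annotate t [])"
  let ?le = "filter (\<lambda>i. cost i \<le> K) ?is"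
  have "set (map edge ?is) = arcs G"
    by (simp add: annotate_represents(2)[OF assms] image_image)
  hence len: "length ?is = card (arcs G)"
    using distinct_card[OF annotate_represents(1)[OF assms]] by simp
  have le: "length ?le \<le> length ?is"
    by (rule length_filter_le)
  have "T_select (length ?le - N) (map item_key ?le) \<le> 2000 * length ?le + 2704"
    if "N < length ?le" "N \<noteq> 0"
    using T_select_le[of "length ?le - N" "map item_key ?le"] that by simp
  moreover have "1 \<le> card (arcs G)"
    using arcs_nonempty by (simp add: Suc_le_eq card_gt_0_iff)
  ultimately show ?thesis
    using le T_annotate_eq[of t "[]"]
    by (auto simp: T_algorithm_A_def Let_def T_filter T_map T_length T_sum_items_eq len
        sum_list_triv)
qed

end

text \<open>\<open>C\<close> is chosen before the tree, the weights, \<open>K\<close> and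
  \<open>N\<close>, so the bound is uniform, as O(n) with \<open>n = card (arcs G)\<close> requires.
  Optimality presupposes that some weight vector is feasible.\<close>

theorem lemma7:
  "\<exists>C::nat. \<forall>(G :: ('v, 'e::linorder) pre_digraph) s w u c K N t.
     sdiptc G s w u c \<longrightarrow> sdiptc.represents G s w u c t \<longrightarrow>
     (let x = sdiptc.output_weight G s w u c K N;
          (xs, z) = algorithm_A t K N
      in ((\<exists>y. sdiptc.feasible G w u c K N y) \<longrightarrow> sdiptc.optimal G s w u c K N x) \<and>
         distinct (map fst xs) \<and> set xs = (\<lambda>e. (e, x e)) ` arcs G \<and>
         z = sdiptc.tree_weight G s x \<and>
         T_algorithm_A t K N \<le> C * card (arcs G))"
proof (intro exI[of _ 5000] allI impI)
  fix G :: "('v, 'e) pre_digraph" and s w u c K N t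
  assume "sdiptc G s w u c" and t: "sdiptc.represents G s w u c t"
  then interpret sdiptc G s w u c by simp
  obtain xs z where "algorithm_A t K N = (xs, z)"
    by fastforce
  thus "let x = output_weight K N; (xs, z) = algorithm_A t K N
      in ((\<exists>y. feasible K N y) \<longrightarrow> optimal K N x) \<and>
         distinct (map fst xs) \<and> set xs = (\<lambda>e. (e, x e)) ` arcs G \<and>
         z = tree_weight x \<and> T_algorithm_A t K N \<le> 5000 * card (arcs G)"
    using algorithm_A_correct[OF t, of K N] optimal_output_weight T_algorithm_A_le[OF t, of K N]
    by (auto simp: Let_def)
qed

end
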